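(* Let $A \in \mathbb{R}^{n \times n}$ be a nonzero matrix with $\mathcal{R}(A) = \mathcal{R}(A^{\mathsf{T}})$. Let $\boldsymbol{b} \in \mathcal{R}(A)$, $\boldsymbol{x}_0 \in \mathbb{R}^n$, $\boldsymbol{r}_0 = \boldsymbol{b} - A\boldsymbol{x}_0$, and let $k \geq 1$ be such that $\dim \mathcal{K}_k(A,\boldsymbol{r}_0) = k$. Then the extended Hessenberg matrix $H_{k+1,k}$ of GMRES satisfies $$\kappa(H_{k+1,k}) \leq \kappa(A|_{\mathcal{R}(A)}) = \kappa(A).$$
   Context: $\mathcal{R}(\cdot)$ denotes range, $\|\cdot\|$ is the Euclidean vector norm and the induced matrix norm, and $\kappa(M) = \|M\|\,\|M^\dagger\|$ for a matrix $M$, with $M^\dagger$ the Moore-Penrose pseudoinverse. For a nonzero subspace $\mathcal{S}\subseteq\mathbb{R}^n$, $A|_{\mathcal{S}}$ is the restriction of $A$ to $\mathcal{S}$ and $$\kappa(A|_{\mathcal{S}}) = \frac{\max_{\boldsymbol{z}\in\mathcal{S}\setminus\{\boldsymbol{0}\}} \|A\boldsymbol{z}\|/\|\boldsymbol{z}\|}{\min_{\boldsymbol{z}\in\mathcal{S}\setminus\{\boldsymbol{0}\}} \|A\boldsymbol{z}\|/\|\boldsymbol{z}\|}.$$ $\mathcal{K}_k(A,\boldsymbol{r}_0) = \mathrm{span}\{\boldsymbol{r}_0, A\boldsymbol{r}_0, \dots, A^{k-1}\boldsymbol{r}_0\}$ is the Krylov subspace. The extended Hessenberg matrix $H_{k+1,k}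 \in \mathbb{R}^{(k+1)\times k}$ comes from the Arnoldi decomposition $A Q_k = Q_{k+1} H_{k+1,k}$, where $Q_k = [\boldsymbol{q}_1,\dots,\boldsymbol{q}_k]$ has orthonormal columns with $\boldsymbol{q}_1 = \boldsymbol{r}_0/\|\boldsymbol{r}_0\|$ and $\mathrm{span}\{\boldsymbol{q}_1,\dots,\boldsymbol{q}_i\} = \mathcal{K}_i(A,\boldsymbol{r}_0)$ for $i\le k$, and $Q_{k+1} = [Q_k,\boldsymbol{q}_{k+1}]$ where $\boldsymbol{q}_{k+1}$ extends this to an orthonormal basis of $\mathcal{K}_{k+1}(A,\boldsymbol{r}_0)$ if $\dim \mathcal{K}_{k+1}(A,\boldsymbol{r}_0) = k+1$; if $\dim \mathcal{K}_{k+1}(A,\boldsymbol{r}_0) = k$, the last row of $H_{k+1,k}$ is zero and $A Q_k = Q_k H_{k,k}$ with $H_{k,k}$ the first $k$ rows. In particular $\|A Q_k \boldsymbol{w}\| = \|H_{k+1,k}\boldsymbol{w}\|$ for all $\boldsymbol{w}\in\mathbb{R}^k$. *)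

theory Defs
  imports Complex_Main "Jordan_Normal_Form.VS_Connect"
begin

text \<open>Dimensions vary inside the statement (\<open>H\<close> is of size \<open>(k+1) \<times> k\<close>), so matrices and vectors
  are those of Jordan_Normal_Form, whose dimensions are carried by \<^const>\<open>carrier_mat\<close> and
  \<^const>\<open>carrier_vec\<close>. Their indices start at 0.\<close>

definition vnorm :: "real vec \<Rightarrow> real" where
  "vnorm v = sqrt (v \<bullet> v)"

definition mnorm :: "real mat \<Rightarrow> real" where
  "mnorm M = (SUP x \<in> carrier_vec (dim_col M) - {0\<^sub>v (dim_col M)}. vnorm (M *\<^sub>v x) / vnorm x)"

definition mat_range :: "real mat \<Rightarrow> real vec set" where
  "mat_range M = (\<lambda>x. M *\<^sub>v x) ` carrier_vec (dim_col M)"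

text \<open>The Moore-Penrose pseudoinverse, as the unique solution of the four Penrose equations.\<close>

definition is_pinv :: "real mat \<Rightarrow> real mat \<Rightarrow> bool" where
  "is_pinv M X \<longleftrightarrow> X \<in> carrier_mat (dim_col M) (dim_row M) \<and>
     M * X * M = M \<and> X * M * X = X \<and> (M * X)\<^sup>T = M * X \<and> (X * M)\<^sup>T = X * M"

definition pinv :: "real mat \<Rightarrow> real mat" where
  "pinv M = (THE X. is_pinv M X)"

definition cond_num :: "real mat \<Rightarrow> real" where
  "cond_num M = mnorm M * mnorm (pinv M)"

text \<open>The numerator and the denominator are a genuine maximum and a genuine minimum. If \<open>M\<close> is not
  injective on \<open>S\<close>, the minimum is 0 and the quotient is 0 by convention instead of infinite.\<close>

definition cond_num_on :: "real mat \<Rightarrow> real vec set \<Rightarrow> real" where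
  "cond_num_on M S =
     (GREATEST t. \<exists>z \<in> S - {0\<^sub>v (dim_col M)}. t = vnorm (M *\<^sub>v z) / vnorm z) /
     (LEAST t. \<exists>z \<in> S - {0\<^sub>v (dim_col M)}. t = vnorm (M *\<^sub>v z) / vnorm z)"

definition vspan :: "nat \<Rightarrow> real vec set \<Rightarrow> real vec set" where
  "vspan n S = LinearCombinations.module.span class_ring (module_vec TYPE(real) n) S"

definition subspace_dim :: "nat \<Rightarrow> real vec set \<Rightarrow> nat" where
  "subspace_dim n S = vectorspace.dim class_ring ((module_vec TYPE(real) n)\<lparr>carrier := S\<rparr>)"

definition krylov :: "real mat \<Rightarrow> real vec \<Rightarrow> nat \<Rightarrow> real vec set" where
  "krylov A r k = vspan (dim_vec r) ((\<lambda>i. (A ^\<^sub>m i) *\<^sub>v r) ` {..<k})"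

definition orthonormal :: "real vec list \<Rightarrow> bool" where
  "orthonormal vs \<longleftrightarrow>
     (\<forall>i < length vs. \<forall>j < length vs. vs ! i \<bullet> vs ! j = (if i = j then 1 else 0))"

text \<open>\<open>qs\<close> lists the columns \<open>q\<^sub>1, \<dots>, q\<^sub>k\<close> of \<open>Q\<^sub>k\<close>, and \<open>H\<close> is the extended Hessenberg
  matrix \<open>H\<^bsub>k+1,k\<^esub>\<close>. The last row of \<open>H\<close> has index \<open>k\<close>. The two final conjuncts
  are the regular case and the breakdown case; in the latter there is no \<open>q\<^bsub>k+1\<^esub>\<close>.\<close>

definition arnoldi :: "real mat \<Rightarrow> real vec \<Rightarrow> nat \<Rightarrow> real vec list \<Rightarrow> real mat \<Rightarrow> bool" where
  "arnoldi A r k qs H \<longleftrightarrow>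
     (let n = dim_vec r in
       length qs = k \<and> set qs \<subseteq> carrier_vec n \<and> orthonormal qs \<and>
       qs ! 0 = (1 / vnorm r) \<cdot>\<^sub>v r \<and>
       (\<forall>i \<in> {1..k}. vspan n (set (take i qs)) = krylov A r i) \<and>
       H \<in> carrier_mat (k + 1) k \<and>
       (subspace_dim n (krylov A r (k + 1)) = k + 1 \<longrightarrow>
         (\<exists>q \<in> carrier_vec n.
            orthonormal (qs @ [q]) \<and> vspan n (set (qs @ [q])) = krylov A r (k + 1) \<and>
            A * mat_of_cols n qs = mat_of_cols n (qs @ [q]) * H)) \<and>
       (subspace_dim n (krylov A r (k + 1)) = k \<longrightarrow>
         row H k = 0\<^sub>v k \<and>
         A * mat_of_cols n qs = mat_of_cols n qs * mat k k (\<lambda>(i, j). H $$ (i, j))))"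

end

theory Submission
  imports Defs "HOL-Analysis.Function_Topology" "Jordan_Normal_Form.DL_Rank"
begin

text \<open>For every nonzero \<open>M\<close> the products \<open>M\<^sup>\<dagger> M\<close> and \<open>M M\<^sup>\<dagger>\<close> are orthogonal projections, the former onto
  \<open>\<R>(M\<^sup>T)\<close>. Hence \<open>\<parallel>M\<parallel>\<close> is the maximum and \<open>1 / \<parallel>M\<^sup>\<dagger>\<parallel>\<close> the (positive) minimum of
  \<open>\<parallel>M z\<parallel> / \<parallel>z\<parallel>\<close> over \<open>\<R>(M\<^sup>T)\<close>, that is, \<open>\<kappa>(M) = \<kappa>(M|\<^bsub>\<R>(M\<^sup>T)\<^esub>)\<close>; with \<open>\<R>(A\<^sup>T) = \<R>(A)\<close> this is the equality.
  Since \<open>r\<^sub>0 \<in> \<R>(A)\<close>, the Krylov space lies in \<open>\<R>(A)\<close>, and \<open>\<parallel>H w\<parallel> / \<parallel>w\<parallel> = \<parallel>A Q w\<parallel> / \<parallel>Q w\<parallel>\<close> shows that all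
  quotients of \<open>H\<close> are among those of \<open>A\<close> on \<open>\<R>(A)\<close>.\<close>

section \<open>Euclidean norm, orthogonal projections and attained extrema\<close>

lemma scalar_prod_self_eq_sum: "(v :: real vec) \<bullet> v = (\<Sum>i<dim_vec v. (v $ i)\<^sup>2)"
  by (simp add: scalar_prod_def power2_eq_square atLeast0LessThan)

lemma scalar_prod_self_nonneg: "0 \<le> (v :: real vec) \<bullet> v"
  by (simp add: scalar_prod_self_eq_sum sum_nonneg)

lemma scalar_prod_self_eq_0:
  assumes "(v :: real vec) \<in> carrier_vec n" "v \<bullet> v = 0"
  shows "v = 0\<^sub>v n"
  using assms by (auto simp: scalar_prod_self_eq_sum sum_nonneg_eq_0_iff)

lemma vnorm_nonneg: "0 \<le> vnorm v"
  by (simp add: vnorm_def scalar_prod_self_nonneg)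

lemma vnorm_power2: "(vnorm v)\<^sup>2 = v \<bullet> v"
  by (simp add: vnorm_def scalar_prod_self_nonneg)

lemma vnorm_zero [simp]: "vnorm (0\<^sub>v n) = 0"
  by (simp add: vnorm_def)

lemma vnorm_pos:
  assumes "v \<in> carrier_vec n" "v \<noteq> 0\<^sub>v n"
  shows "0 < vnorm v"
  using scalar_prod_self_eq_0[OF assms(1)] scalar_prod_self_nonneg[of v] assms(2)
  by (force simp: vnorm_def)

lemma vnorm_smult: "vnorm (c \<cdot>\<^sub>v v) = \<bar>c\<bar> * vnorm v"
proof -
  have "(c \<cdot>\<^sub>v v) \<bullet> (c \<cdot>\<^sub>v v) = c\<^sup>2 * (v \<bullet> v)"
    by (simp add: scalar_prod_self_eq_sum power_mult_distrib sum_distrib_left)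
  then show ?thesis by (simp add: vnorm_def real_sqrt_mult)
qed

text \<open>For \<open>p = P *\<^sub>v y\<close>, symmetry and idempotence give p.p = y.p, so that
  |y - p|^2 = |y|^2 - |p|^2, which is nonnegative.\<close>

lemma vnorm_symmetric_idempotent_le:
  assumes P: "P \<in> carrier_mat n n" and sym: "P\<^sup>T = P" and idem: "P * P = P"
    and y: "y \<in> carrier_vec n"
  shows "vnorm (P *\<^sub>v y) \<le> vnorm y"
proof -
  define p where "p = P *\<^sub>v y"
  have p: "p \<in> carrier_vec n" using P y by (simp add: p_def)
  have Pp: "P *\<^sub>v p = p"
    using assoc_mult_mat_vec[OF P P y] idem by (simp add: p_def)
  have pp: "p \<bullet> p = y \<bullet> p"
    using transpose_vec_mult_scalar[OF P p y] Pp by (simp add: sym p_def)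
  have "(y - p) \<bullet> (y - p) = y \<bullet> y - p \<bullet> y - (y \<bullet> p - p \<bullet> p)"
    using y p by (simp add: minus_scalar_prod_distrib[of _ n] scalar_prod_minus_distrib[of _ n])
  also have "p \<bullet> y = y \<bullet> p" by (rule comm_scalar_prod[OF p y])
  finally have "p \<bullet> p \<le> y \<bullet> y" using scalar_prod_self_nonneg[of "y - p"] pp by simp
  then show ?thesis by (simp add: vnorm_def p_def)
qed

text \<open>The subspace \<open>S\<close> is given as a fixed-point set so that it is visibly closed; it is applied to
  the row space of \<open>M\<close>, with \<open>P = M\<^sup>\<dagger> M\<close>.\<close>

lemma quotient_extrema:
  assumes M: "M \<in> carrier_mat m n" and P: "P \<in> carrier_mat n n"
    and S: "S = {z \<in> carrier_vec n. P *\<^sub>v z = z}" and ne: "z0 \<in> S" "z0 \<noteq> 0\<^sub>v n"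
  obtains u l where "u \<in> S - {0\<^sub>v n}" "l \<in> S - {0\<^sub>v n}"
    "\<And>z. z \<in> S - {0\<^sub>v n} \<Longrightarrow> vnorm (M *\<^sub>v z) / vnorm z \<le> vnorm (M *\<^sub>v u) / vnorm u"
    "\<And>z. z \<in> S - {0\<^sub>v n} \<Longrightarrow> vnorm (M *\<^sub>v l) / vnorm l \<le> vnorm (M *\<^sub>v z) / vnorm z"
proof -
  define q where "q z = vnorm (M *\<^sub>v z) / vnorm z" for z
  \<comment> \<open>Spelled out in coordinates, so that continuity of \<open>g\<close> reduces to
    continuity of the coordinate projections.\<close>
  define g where "g f = sqrt (\<Sum>i<m. (\<Sum>j<n. M $$ (i,j) * f j)\<^sup>2)" for f :: "nat \<Rightarrow> real"
  \<comment> \<open>Vectors of \<open>carrier_vec n\<close> are encoded as functions vanishing from \<open>n\<close> on, so that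
    \<open>B\<close> is compact by Tychonoff's theorem.\<close>
  define B where "B = PiE UNIV (\<lambda>i. if i < n then {-1..1::real} else {0})"
  \<comment> \<open>The unit sphere of the fixed space of \<open>P\<close>. It is cut out by
    finitely many continuous equations and hence closed; the box \<open>B\<close> contributes
    compactness.\<close>
  define C where "C = {f. (\<Sum>i<n. (f i)\<^sup>2) = 1 \<and> (\<forall>i\<in>{..<n}. (\<Sum>j<n. P $$ (i,j) * f j) = f i)}"
  define K where "K = B \<inter> C"
  have entry: "(N *\<^sub>v vec n f) $ i = (\<Sum>j<n. N $$ (i,j) * f j)"
    if "N \<in> carrier_mat r n" "i < r" for N :: "real mat" and r i f
    using that by (auto simp: scalar_prod_def atLeast0LessThan intro!: sum.cong)
  have "compactin (product_topology (\<lambda>i. euclidean) UNIV) B"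
    unfolding B_def compactin_PiE by auto
  then have "compact B" by (simp add: euclidean_product_topology)
  moreover have "closed C"
    unfolding C_def Collect_conj_eq Collect_ball_eq
    by (intro closed_Int closed_INT ballI closed_Collect_eq continuous_intros continuous_on_product_coordinates)
  ultimately have cK: "compact K" unfolding K_def by (rule compact_Int_closed)
  have cg: "continuous_on K g" unfolding g_def by (intro continuous_intros continuous_on_subset[OF continuous_on_product_coordinates] subset_UNIV)
  \<comment> \<open>The quotient is invariant under scaling, so \<open>z\<close> may be normalised.
    The coordinates of a unit vector lie between -1 and 1, which is why the box \<open>B\<close> is
    large enough.\<close>
  have toK: "\<exists>f\<in>K. g f = q z" if z: "z \<in> S - {0\<^sub>v n}" for z
  proof -
    have zc: "z \<in> carrier_vec n" and Pz: "P *\<^sub>v z = z" and zp: "vnorm z > 0"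
      using z vnorm_pos[of z n] by (auto simp: S)
    define f where "f i = (if i < n then z $ i / vnorm z else 0)" for i
    have fz: "vec n f = (1 / vnorm z) \<cdot>\<^sub>v z" using zc by (auto simp: f_def)
    have "(vnorm (vec n f))\<^sup>2 = 1" using zp by (simp add: fz vnorm_smult)
    then have sq: "(\<Sum>i<n. (f i)\<^sup>2) = 1" unfolding vnorm_power2 scalar_prod_self_eq_sum by simp
    have "(\<Sum>j<n. P $$ (i,j) * f j) = f i" if "i < n" for i
      using entry[OF P that, of f] zc P Pz that by (simp add: fz mult_mat_vec[of P n n] f_def)
    moreover have "f i \<in> {-1..1}" if "i < n" for i
    proof -
      have "(f i)\<^sup>2 \<le> (\<Sum>i<n. (f i)\<^sup>2)" using that by (intro member_le_sum) auto
      then have "\<bar>f i\<bar> \<le> 1" using sq abs_square_le_1[of "f i"] by simp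
      then show ?thesis by auto
    qed
    then have "f \<in> B" unfolding B_def by (auto simp: f_def)
    ultimately have "f \<in> K" using sq by (simp add: K_def C_def)
    moreover have "g f = vnorm (M *\<^sub>v vec n f)"
      unfolding g_def vnorm_def scalar_prod_self_eq_sum using M
      by (intro arg_cong[of _ _ sqrt] sum.cong) (auto simp: entry[OF M] simp del: index_mult_mat_vec)
    moreover have "\<dots> = q z"
      using zc M zp by (simp add: fz mult_mat_vec[of M m n] vnorm_smult q_def)
    ultimately show ?thesis by metis
  qed
  \<comment> \<open>Conversely, every point of \<open>K\<close> encodes a unit vector of
    \<open>S\<close>, so the extrema of \<open>g\<close> on \<open>K\<close> are values of the
    quotient on \<open>S\<close>.\<close>
  have ofK: "\<exists>z\<in>S - {0\<^sub>v n}. g f = q z" if "f \<in> K" for f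
  proof (intro bexI)
    have sq: "(\<Sum>i<n. (f i)\<^sup>2) = 1" and Pf: "\<forall>i<n. (\<Sum>j<n. P $$ (i,j) * f j) = f i"
      using that by (auto simp: K_def C_def)
    have n1: "vnorm (vec n f) = 1" using sq by (simp add: vnorm_def scalar_prod_self_eq_sum)
    have "g f = vnorm (M *\<^sub>v vec n f)"
      unfolding g_def vnorm_def scalar_prod_self_eq_sum using M
      by (intro arg_cong[of _ _ sqrt] sum.cong) (auto simp: entry[OF M] simp del: index_mult_mat_vec)
    then show "g f = q (vec n f)" by (simp add: q_def n1)
    have "P *\<^sub>v vec n f = vec n f"
      using P Pf by (intro eq_vecI) (auto simp: entry[OF P] simp del: index_mult_mat_vec)
    then show "vec n f \<in> S - {0\<^sub>v n}" using n1 by (auto simp: S)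
  qed
  have "K \<noteq> {}" using toK[of z0] ne by auto
  obtain a b where a: "a \<in> K" "\<forall>f\<in>K. g f \<le> g a" and b: "b \<in> K" "\<forall>f\<in>K. g b \<le> g f"
    using continuous_attains_sup[OF cK \<open>K \<noteq> {}\<close> cg] continuous_attains_inf[OF cK \<open>K \<noteq> {}\<close> cg]
    by metis
  obtain u l where ul: "u \<in> S - {0\<^sub>v n}" "l \<in> S - {0\<^sub>v n}" "g a = q u" "g b = q l"
    using ofK a b by metis
  have "q z \<le> q u \<and> q l \<le> q z" if "z \<in> S - {0\<^sub>v n}" for z
    using toK[OF that] a b ul by auto
  then show thesis using that[OF ul(1,2)] by (auto simp: q_def)
qed

section \<open>Invertibility, kernels and matrices with orthonormal columns\<close>

lemma mat_eq_if_mult_vec_eq: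
  assumes A: "(A :: real mat) \<in> carrier_mat m n" and B: "B \<in> carrier_mat m n"
    and eq: "\<And>x. x \<in> carrier_vec n \<Longrightarrow> A *\<^sub>v x = B *\<^sub>v x"
  shows "A = B"
proof (rule eq_matI)
  fix i j assume "i < dim_row B" "j < dim_col B"
  then have ij: "i < m" "j < n" using B by auto
  have "(A *\<^sub>v unit_vec n j) $ i = (B *\<^sub>v unit_vec n j) $ i" by (simp add: eq)
  then show "A $$ (i,j) = B $$ (i,j)" using A B ij by simp
qed (use A B in auto)

lemma mat_inverse_if_kernel_trivial:
  assumes C: "(C :: real mat) \<in> carrier_mat n n"
    and ker: "\<And>w. w \<in> carrier_vec n \<Longrightarrow> C *\<^sub>v w = 0\<^sub>v n \<Longrightarrow> w = 0\<^sub>v n"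
  obtains D where "D \<in> carrier_mat n n" "D * C = 1\<^sub>m n" "C * D = 1\<^sub>m n"
proof -
  have "det C \<noteq> 0" using det_0_iff_vec_prod_zero_field[OF C] ker by blast
  \<comment> \<open>The parameter \<open>b\<close> of the matrix ring only fills the extension slot
    of the ring record; \<open>()\<close> fixes its type.\<close>
  then show thesis
    using det_non_zero_imp_unit[OF C, where b = "()"] that
    by (auto simp: Units_def ring_mat_def)
qed

text \<open>Padding \<open>Q\<close> with zero rows to a square matrix \<open>C\<close> keeps the
  kernel. Row \<open>n\<close> of \<open>C\<close> vanishes, so the transpose of \<open>C\<close>
  annihilates a unit vector and the determinant is 0.\<close>

lemma kernel_nontrivial_if_wide:
  assumes Q: "(Q :: real mat) \<in> carrier_mat n r" and "n < r"
  obtains w where "w \<in> carrier_vec r" "w \<noteq> 0\<^sub>v r" "Q *\<^sub>v w = 0\<^sub>v n"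
proof -
  define C where "C = mat r r (\<lambda>(i,j). if i < n then Q $$ (i,j) else 0)"
  have C: "C \<in> carrier_mat r r" by (simp add: C_def)
  have "C\<^sup>T *\<^sub>v unit_vec r n = 0\<^sub>v r" using assms by (intro eq_vecI) (auto simp: C_def)
  then have "det C = 0"
    using det_0_iff_vec_prod_zero_field[of "C\<^sup>T" r] det_transpose[OF C] C assms(2)
    by (metis transpose_carrier_mat unit_vec_carrier unit_vec_nonzero)
  then obtain w where w: "w \<in> carrier_vec r" "w \<noteq> 0\<^sub>v r" "C *\<^sub>v w = 0\<^sub>v r"
    using det_0_iff_vec_prod_zero_field[OF C] by blast
  have "Q *\<^sub>v w = 0\<^sub>v n"
  proof (rule eq_vecI)
    fix i assume i: "i < dim_vec (0\<^sub>v n :: real vec)"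
    have "row Q i = row C i" using i assms by (auto simp: C_def)
    moreover have "(C *\<^sub>v w) $ i = 0" using i assms w(3) by simp
    ultimately show "(Q *\<^sub>v w) $ i = 0\<^sub>v n $ i" using i assms C by simp
  qed (use Q in auto)
  then show thesis using that w by blast
qed

text \<open>Splits off the contribution of the last column, for the extension of an orthonormal list
  by one vector.\<close>

lemma mat_of_cols_snoc_mult:
  assumes "length vs = r" "v \<in> carrier_vec n" "w \<in> carrier_vec r"
  shows "mat_of_cols n (vs @ [v]) *\<^sub>v (w @\<^sub>v vec 1 (\<lambda>_. c)) = mat_of_cols n vs *\<^sub>v w + c \<cdot>\<^sub>v (v :: real vec)"
proof (rule eq_vecI)
  fix i assume "i < dim_vec (mat_of_cols n vs *\<^sub>v w + c \<cdot>\<^sub>v v)"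
  then show "(mat_of_cols n (vs @ [v]) *\<^sub>v (w @\<^sub>v vec 1 (\<lambda>_. c))) $ i
      = (mat_of_cols n vs *\<^sub>v w + c \<cdot>\<^sub>v v) $ i"
    using assms
    by (auto simp: scalar_prod_def mat_of_cols_def nth_append intro!: sum.cong)
qed (use assms in auto)

lemma orthonormal_iff_gram:
  assumes "set vs \<subseteq> carrier_vec n"
  shows "orthonormal vs \<longleftrightarrow> (mat_of_cols n vs)\<^sup>T * mat_of_cols n vs = 1\<^sub>m (length vs)"
proof -
  have "col (mat_of_cols n vs) i = vs ! i" if "i < length vs" for i
    using that assms nth_mem by (intro col_mat_of_cols) blast+
  then show ?thesis
    by (auto simp: orthonormal_def mat_eq_iff)
qed

lemma vnorm_orthonormal_mult:
  assumes Q: "(Q :: real mat) \<in> carrier_mat n r" and QQ: "Q\<^sup>T * Q = 1\<^sub>m r"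
    and w: "w \<in> carrier_vec r"
  shows "vnorm (Q *\<^sub>v w) = vnorm w"
proof -
  have "Q\<^sup>T *\<^sub>v (Q *\<^sub>v w) = w"
    using assoc_mult_mat_vec[of "Q\<^sup>T" r n Q r w] Q QQ w by simp
  then have "(Q *\<^sub>v w) \<bullet> (Q *\<^sub>v w) = w \<bullet> w"
    using transpose_vec_mult_scalar[OF Q w, of "Q *\<^sub>v w"] Q w by simp
  then show ?thesis by (simp add: vnorm_def)
qed

text \<open>A longer list would give a wide matrix with a nonzero kernel vector, although
  orthonormal columns preserve the norm.\<close>

lemma orthonormal_length_le:
  assumes "set vs \<subseteq> carrier_vec n" "orthonormal vs"
  shows "length vs \<le> n"
proof (rule ccontr)
  assume "\<not> ?thesis"
  then obtain w where w: "w \<in> carrier_vec (length vs)" "w \<noteq> 0\<^sub>v (length vs)"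
      "mat_of_cols n vs *\<^sub>v w = 0\<^sub>v n"
    using kernel_nontrivial_if_wide[of "mat_of_cols n vs" n "length vs"] by auto
  then show False
    using vnorm_orthonormal_mult[of "mat_of_cols n vs" n "length vs" w] vnorm_pos[of w]
      orthonormal_iff_gram[OF assms(1)] assms(2) by auto
qed

section \<open>Ranges of matrices and their orthonormal bases\<close>

text \<open>Connects ranges to the module in which \<open>vspan\<close> is defined, so that a span
  of elements of a range stays in that range.\<close>

lemma mat_range_submodule:
  assumes M: "M \<in> carrier_mat n m"
  shows "submodule class_ring (mat_range M) (module_vec TYPE(real) n)"
proof -
  interpret vec_module "TYPE(real)" n .
  show ?thesis
  proof (unfold_locales)
    show "mat_range M \<subseteq> carrier (module_vec TYPE(real) n)"
      using M by (auto simp: mat_range_def module_vec_simps)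
    show "\<zero>\<^bsub>module_vec TYPE(real) n\<^esub> \<in> mat_range M"
      using M by (auto simp: mat_range_def module_vec_simps intro!: image_eqI[of _ _ "0\<^sub>v m"])
  next
    fix v w assume "v \<in> mat_range M" "w \<in> mat_range M"
    then obtain x y where "x \<in> carrier_vec m" "y \<in> carrier_vec m" "v = M *\<^sub>v x" "w = M *\<^sub>v y"
      using M by (auto simp: mat_range_def)
    then show "v \<oplus>\<^bsub>module_vec TYPE(real) n\<^esub> w \<in> mat_range M"
      using M by (auto simp: mat_range_def module_vec_simps mult_add_distrib_mat_vec[symmetric])
  next
    fix c v assume "v \<in> mat_range M"
    then obtain x where "x \<in> carrier_vec m" "v = M *\<^sub>v x"
      using M by (auto simp: mat_range_def)
    then show "c \<odot>\<^bsub>module_vec TYPE(real) n\<^esub> v \<in> mat_range M"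
      using M by (auto simp: mat_range_def module_vec_simps mult_mat_vec[symmetric])
  qed
qed

lemma mat_range_diff_mult_closed:
  assumes M: "M \<in> carrier_mat n m" and K: "K \<in> carrier_mat n r"
    and "mat_range K \<subseteq> mat_range M" "v \<in> mat_range M" "w \<in> carrier_vec r"
  shows "v - K *\<^sub>v w \<in> mat_range M"
proof -
  have "K *\<^sub>v w \<in> mat_range M" using assms(3,5) K by (auto simp: mat_range_def)
  then obtain x y where "x \<in> carrier_vec m" "v = M *\<^sub>v x" "y \<in> carrier_vec m" "K *\<^sub>v w = M *\<^sub>v y"
    using assms(4) M by (auto simp: mat_range_def)
  then show ?thesis
    using M by (auto simp: mat_range_def mult_minus_distrib_mat_vec[symmetric])
qed

text \<open>Take a longest orthonormal list whose span lies in the range of \<open>M\<close>;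
  lengths are bounded by \<open>n\<close>. If \<open>Q * Q\<^sup>T\<close> moved some vector of the
  range, one Gram-Schmidt step would lengthen the list.\<close>

lemma mat_range_orthonormal_basis:
  assumes M: "M \<in> carrier_mat n m"
  obtains Q r where "Q \<in> carrier_mat n r" "Q\<^sup>T * Q = 1\<^sub>m r" "mat_range Q = mat_range M"
    "Q * Q\<^sup>T * M = M"
proof -
  define L where "L = (\<lambda>vs. orthonormal vs \<and> set vs \<subseteq> carrier_vec n \<and>
    mat_range (mat_of_cols n vs) \<subseteq> mat_range M)"
  \<comment> \<open>A matrix without columns has range {0}, and 0 is the image of 0 under
    \<open>M\<close>.\<close>
  have "L []" using M
    by (auto simp: L_def orthonormal_def mat_range_def image_iff scalar_prod_def intro!: bexI[of _ "0\<^sub>v m"] eq_vecI)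
  moreover have "\<forall>vs. L vs \<longrightarrow> length vs < Suc n"
    using orthonormal_length_le by (auto simp: L_def less_Suc_eq_le)
  ultimately obtain vs where vs: "L vs" and mx: "\<And>ws. L ws \<Longrightarrow> length ws \<le> length vs"
    using ex_has_greatest_nat[of L "[]" length "Suc n"] by auto
  define Q where "Q = mat_of_cols n vs"
  define r where "r = length vs"
  have Q: "Q \<in> carrier_mat n r" by (simp add: Q_def r_def)
  have vsc: "set vs \<subseteq> carrier_vec n" and sub: "mat_range Q \<subseteq> mat_range M"
    using vs by (auto simp: L_def Q_def)
  have QQ: "Q\<^sup>T * Q = 1\<^sub>m r"
    using vs orthonormal_iff_gram[of vs n] by (simp add: L_def Q_def r_def)
  have fixed: "Q *\<^sub>v (Q\<^sup>T *\<^sub>v v) = v" if v: "v \<in> mat_range M" for v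
  proof (rule ccontr)
    assume ne: "Q *\<^sub>v (Q\<^sup>T *\<^sub>v v) \<noteq> v"
    have vc: "v \<in> carrier_vec n" using v M by (auto simp: mat_range_def)
    \<comment> \<open>The Gram-Schmidt residual of \<open>v\<close>: it stays in the range of
      \<open>M\<close>, is nonzero by \<open>ne\<close>, and is orthogonal to all columns of
      \<open>Q\<close>.\<close>
    define u where "u = v - Q *\<^sub>v (Q\<^sup>T *\<^sub>v v)"
    have wc: "Q\<^sup>T *\<^sub>v v \<in> carrier_vec r" using Q vc by simp
    have uc: "u \<in> carrier_vec n" using Q vc by (simp add: u_def)
    have uM: "u \<in> mat_range M"
      unfolding u_def by (rule mat_range_diff_mult_closed[OF M Q sub v wc])
    have "u \<noteq> 0\<^sub>v n"
    proof
      assume u0: "u = 0\<^sub>v n"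
      have "Q *\<^sub>v (Q\<^sup>T *\<^sub>v v) = v"
      proof (rule eq_vecI)
        fix i assume "i < dim_vec v"
        then show "(Q *\<^sub>v (Q\<^sup>T *\<^sub>v v)) $ i = v $ i"
          using arg_cong[OF u0, of "\<lambda>x. x $ i"] vc Q unfolding u_def by auto
      qed (use Q vc in auto)
      with ne show False by simp
    qed
    then have up: "vnorm u > 0" using vnorm_pos uc by blast
    have Qu: "Q\<^sup>T *\<^sub>v u = 0\<^sub>v r"
    proof -
      have "Q\<^sup>T *\<^sub>v u = Q\<^sup>T *\<^sub>v v - Q\<^sup>T *\<^sub>v (Q *\<^sub>v (Q\<^sup>T *\<^sub>v v))"
        unfolding u_def using Q vc wc
        by (intro mult_minus_distrib_mat_vec[of _ r n]) auto
      also have "Q\<^sup>T *\<^sub>v (Q *\<^sub>v (Q\<^sup>T *\<^sub>v v)) = Q\<^sup>T *\<^sub>v v"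
        using assoc_mult_mat_vec[of "Q\<^sup>T" r n Q r "Q\<^sup>T *\<^sub>v v"] Q wc QQ by simp
      finally show ?thesis using wc by simp
    qed
    define q where "q = (1 / vnorm u) \<cdot>\<^sub>v u"
    have qc: "q \<in> carrier_vec n" using uc by (simp add: q_def)
    have qq: "q \<bullet> q = 1"
      using up by (simp add: vnorm_power2[symmetric] q_def vnorm_smult)
    have perp: "vs ! i \<bullet> q = 0" if "i < r" for i
    proof -
      have "vs ! i \<bullet> u = (Q\<^sup>T *\<^sub>v u) $ i"
        using that Q vsc by (simp add: Q_def r_def subset_iff)
      then show ?thesis using Qu that uc vsc
        by (simp add: q_def r_def subset_iff scalar_prod_smult_right)
    qed
    have "orthonormal (vs @ [q])"
      unfolding orthonormal_def
    proof (intro allI impI)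
      fix i j assume ij: "i < length (vs @ [q])" "j < length (vs @ [q])"
      have "q \<bullet> vs ! i = 0" if "i < r" for i
        using perp[OF that] comm_scalar_prod[of q n "vs ! i"] qc vsc that
        by (simp add: r_def subset_iff)
      then show "(vs @ [q]) ! i \<bullet> (vs @ [q]) ! j = (if i = j then 1 else 0)"
        using ij vs perp qq by (auto simp: nth_append r_def L_def orthonormal_def less_Suc_eq)
    qed
    moreover have "mat_range (mat_of_cols n (vs @ [q])) \<subseteq> mat_range M"
    proof
      fix y assume "y \<in> mat_range (mat_of_cols n (vs @ [q]))"
      then obtain x where x: "x \<in> carrier_vec (r + 1)" "y = mat_of_cols n (vs @ [q]) *\<^sub>v x"
        by (auto simp: mat_range_def r_def)
      define w where "w = vec r (($) x)"
      define c where "c = x $ r"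
      have "x = w @\<^sub>v vec 1 (\<lambda>_. c)"
        using x(1) by (intro eq_vecI) (auto simp: w_def c_def less_Suc_eq)
      then have "y = Q *\<^sub>v w + c \<cdot>\<^sub>v q"
        using x(2) mat_of_cols_snoc_mult[of vs r q n w c] qc by (simp add: Q_def r_def w_def)
      moreover have "Q *\<^sub>v w \<in> mat_range M" using sub Q by (auto simp: mat_range_def w_def)
      moreover have "c \<cdot>\<^sub>v q = (c / vnorm u) \<cdot>\<^sub>v u" by (simp add: q_def smult_smult_assoc)
      ultimately show "y \<in> mat_range M"
        using uM submodule.m_closed[OF mat_range_submodule[OF M]]
          submodule.smult_closed[OF mat_range_submodule[OF M]]
        by (auto simp: module_vec_simps class_ring_simps)
    qed
    ultimately have "L (vs @ [q])" using vs qc by (auto simp: L_def)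
    from mx[OF this] show False by simp
  qed
  have "mat_range M \<subseteq> mat_range Q"
  proof
    fix v assume "v \<in> mat_range M"
    then show "v \<in> mat_range Q" using fixed[of v] M Q
      by (auto simp: mat_range_def intro!: image_eqI[of _ _ "Q\<^sup>T *\<^sub>v v"])
  qed
  moreover have "Q * Q\<^sup>T * M = M"
  proof (rule mat_eq_if_mult_vec_eq[of _ n m])
    fix x :: "real vec" assume x: "x \<in> carrier_vec m"
    have "Q * Q\<^sup>T * M *\<^sub>v x = Q *\<^sub>v (Q\<^sup>T *\<^sub>v (M *\<^sub>v x))"
      using Q M x assoc_mult_mat_vec[of "Q * Q\<^sup>T" n n M m x] assoc_mult_mat_vec[of Q n r "Q\<^sup>T" n "M *\<^sub>v x"]
      by (simp del: assoc_mult_mat)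
    also have "\<dots> = M *\<^sub>v x" using fixed[of "M *\<^sub>v x"] x M by (auto simp: mat_range_def)
    finally show "Q * Q\<^sup>T * M *\<^sub>v x = M *\<^sub>v x" .
  qed (use Q M in auto)
  ultimately show thesis using that[OF Q QQ] sub by blast
qed

section \<open>The Moore-Penrose pseudoinverse\<close>

text \<open>\<open>M * X\<close> and \<open>M * Y\<close> are symmetric and each absorbs the other,
  hence they agree; likewise \<open>X * M\<close> and \<open>Y * M\<close>. Then X = XMX = YMX = YMY
  = Y.\<close>

lemma is_pinv_unique:
  assumes X: "is_pinv M X" and Y: "is_pinv M Y"
  shows "X = Y"
proof -
  define m n where "m = dim_row M" and "n = dim_col M"
  have c: "M \<in> carrier_mat m n" "X \<in> carrier_mat n m" "Y \<in> carrier_mat n m"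
    using X Y by (auto simp: is_pinv_def m_def n_def)
  have MX: "M * X = (M * X)\<^sup>T" "M * Y = (M * Y)\<^sup>T" "X * M = (X * M)\<^sup>T" "Y * M = (Y * M)\<^sup>T"
    and pen: "M * X * M = M" "M * Y * M = M" "X * M * X = X" "Y * M * Y = Y"
    using X Y by (auto simp: is_pinv_def)
  have "M * X = M * Y * (M * X)"
    using c pen(2) assoc_mult_mat[of "M * Y" m m M n X m] by simp
  also have "\<dots> = (M * X * (M * Y))\<^sup>T"
    using c MX transpose_mult[of "M * X" m m "M * Y" m] by simp
  also have "M * X * (M * Y) = M * Y"
    using c pen(1) assoc_mult_mat[of "M * X" m m M n Y m] by simp
  finally have 1: "M * X = M * Y" using MX by simp
  have "X * M = X * M * (Y * M)"
    using c pen(2) assoc_mult_mat[of X n m M n "Y * M" n] assoc_mult_mat[of M m n Y m M n] by simp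
  also have "\<dots> = (Y * M * (X * M))\<^sup>T"
    using c MX transpose_mult[of "Y * M" n n "X * M" n] by simp
  also have "Y * M * (X * M) = Y * M"
    using c pen(1) assoc_mult_mat[of Y n m M n "X * M" n] assoc_mult_mat[of M m n X m M n] by simp
  finally have 2: "X * M = Y * M" using MX by simp
  have "X = X * M * X" by (simp add: pen)
  also have "\<dots> = Y * M * Y" using 1 2 c assoc_mult_mat[of Y n m M n X m] assoc_mult_mat[of Y n m M n Y m] by simp
  finally show ?thesis by (simp add: pen)
qed

lemma is_pinv_exists: "\<exists>X. is_pinv M X"
proof -
  define m n where "m = dim_row M" and "n = dim_col M"
  have M: "M \<in> carrier_mat m n" by (simp add: m_def n_def)
  obtain Q r where Q: "Q \<in> carrier_mat m r" and QQ: "Q\<^sup>T * Q = 1\<^sub>m r"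
    and rng: "mat_range Q = mat_range M" and QQM: "Q * Q\<^sup>T * M = M"
    using mat_range_orthonormal_basis[OF M] by blast
  have Qt: "Q\<^sup>T \<in> carrier_mat r m" using Q by simp
  define N where "N = Q\<^sup>T * M"
  have N: "N \<in> carrier_mat r n" and Nt: "N\<^sup>T \<in> carrier_mat n r" using Q M by (auto simp: N_def)
  have M_eq: "M = Q * N" using assoc_mult_mat[OF Q Qt M] QQM by (simp add: N_def)
  define G where "G = N * N\<^sup>T"
  have G: "G \<in> carrier_mat r r" using N by (simp add: G_def)
  \<comment> \<open>A kernel vector \<open>w\<close> of \<open>G\<close> is killed by
    \<open>N\<^sup>T\<close>. Since \<open>Q\<close> and \<open>M\<close> have the same range,
    \<open>w\<close> is also of the form \<open>N *\<^sub>v u\<close>, and is therefore orthogonal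
    to itself.\<close>
  have "w = 0\<^sub>v r" if w: "w \<in> carrier_vec r" and Gw: "G *\<^sub>v w = 0\<^sub>v r" for w
  proof -
    have Ntw: "N\<^sup>T *\<^sub>v w \<in> carrier_vec n" using N w by simp
    have "N *\<^sub>v (N\<^sup>T *\<^sub>v w) = 0\<^sub>v r" using Gw assoc_mult_mat_vec[OF N Nt w] by (simp add: G_def)
    then have "(N\<^sup>T *\<^sub>v w) \<bullet> (N\<^sup>T *\<^sub>v w) = 0"
      using transpose_vec_mult_scalar[OF N Ntw w] w by simp
    then have Nt0: "N\<^sup>T *\<^sub>v w = 0\<^sub>v n" using scalar_prod_self_eq_0[OF Ntw] by simp
    have "Q *\<^sub>v w \<in> mat_range M" using Q w rng by (auto simp: mat_range_def)
    then obtain u where u: "u \<in> carrier_vec n" "Q *\<^sub>v w = M *\<^sub>v u"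
      using M by (auto simp: mat_range_def)
    have "N *\<^sub>v u = Q\<^sup>T *\<^sub>v (Q *\<^sub>v w)" using assoc_mult_mat_vec[OF Qt M u(1)] u(2) by (simp add: N_def)
    also have "\<dots> = w" using assoc_mult_mat_vec[OF Qt Q w] QQ w by simp
    finally have "w \<bullet> w = w \<bullet> (N *\<^sub>v u)" by simp
    also have "\<dots> = (N\<^sup>T *\<^sub>v w) \<bullet> u" using transpose_vec_mult_scalar[OF N u(1) w] by simp
    also have "\<dots> = 0" using Nt0 u by simp
    finally show ?thesis using scalar_prod_self_eq_0[OF w] by simp
  qed
  from mat_inverse_if_kernel_trivial[OF G this]
  obtain D where D: "D \<in> carrier_mat r r" and DG: "D * G = 1\<^sub>m r" and GD: "G * D = 1\<^sub>m r" by blast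
  have "G\<^sup>T = G" using transpose_mult[OF N Nt] by (simp add: G_def)
  \<comment> \<open>The transpose of \<open>D\<close> is a left inverse of the symmetric
    \<open>G\<close> and so coincides with the right inverse \<open>D\<close>.\<close>
  then have DtG: "D\<^sup>T * G = 1\<^sub>m r" using transpose_mult[OF G D] GD by simp
  have "D\<^sup>T = D\<^sup>T * (G * D)" using D GD by simp
  also have "\<dots> = D" using assoc_mult_mat[of "D\<^sup>T" r r G r D r] D G DtG by simp
  finally have Dsym: "D\<^sup>T = D" .
  \<comment> \<open>\<open>M = Q N\<close> is a full rank factorization with orthonormal \<open>Q\<close>, whence
    \<open>M\<^sup>\<dagger> = N\<^sup>T (N N\<^sup>T)\<^sup>-\<^sup>1 Q\<^sup>T\<close>.\<close>
  define X where "X = N\<^sup>T * D * Q\<^sup>T"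
  have X: "X \<in> carrier_mat n m" using N D Q by (simp add: X_def)
  have ND: "N\<^sup>T * D \<in> carrier_mat n r" using N D by simp
  have NX: "N * X = Q\<^sup>T"
    using assoc_mult_mat[OF N ND Qt] assoc_mult_mat[OF N Nt D] GD Q by (simp add: X_def G_def)
  have MX: "M * X = Q * Q\<^sup>T"
    using assoc_mult_mat[OF Q N X] NX M_eq by simp
  have "Q\<^sup>T * M = N" by (simp add: N_def)
  then have XM: "X * M = N\<^sup>T * D * N"
    using assoc_mult_mat[OF ND Qt M] by (simp add: X_def)
  have "X * M * X = N\<^sup>T * D * (N * X)" unfolding XM by (rule assoc_mult_mat[OF ND N X])
  then have XMX: "X * M * X = X" unfolding NX by (simp add: X_def)
  have "(Q * Q\<^sup>T)\<^sup>T = Q * Q\<^sup>T" using transpose_mult[OF Q Qt] by simp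
  moreover have "(N\<^sup>T * D * N)\<^sup>T = N\<^sup>T * D * N"
    using transpose_mult[OF ND N] transpose_mult[OF Nt D] assoc_mult_mat[OF Nt D N] Dsym by simp
  ultimately have "is_pinv M X"
    unfolding is_pinv_def using X M XMX by (simp add: MX XM QQM)
  then show ?thesis ..
qed

lemma pinv_is_pinv: "is_pinv M (pinv M)"
  unfolding pinv_def using is_pinv_exists is_pinv_unique by (metis theI')

lemma pinv_carrier:
  assumes "M \<in> carrier_mat m n"
  shows "pinv M \<in> carrier_mat n m"
  using pinv_is_pinv[of M] assms by (simp add: is_pinv_def)

lemma pinv_penrose:
  "M * pinv M * M = M" "pinv M * M * pinv M = pinv M"
  "(M * pinv M)\<^sup>T = M * pinv M" "(pinv M * M)\<^sup>T = pinv M * M"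
  using pinv_is_pinv[of M] by (auto simp: is_pinv_def)

lemma mat_range_mult_subset:
  assumes "B \<in> carrier_mat m n" "C \<in> carrier_mat n r"
  shows "mat_range (B * C) \<subseteq> mat_range B"
  using assms assoc_mult_mat_vec[OF assms]
  by (auto simp: mat_range_def intro!: image_eqI[of _ _ "C *\<^sub>v _"])

text \<open>Transposing the first Penrose equation shows that \<open>pinv M * M\<close> fixes the
  row space; transposing \<open>pinv M * M\<close> itself shows that fixed points lie in the row
  space. This puts the row space into the form required by \<open>quotient_extrema\<close>.\<close>

lemma mat_range_transpose_eq_fixed:
  assumes M: "M \<in> carrier_mat m n"
  shows "mat_range (M\<^sup>T) = {z \<in> carrier_vec n. (pinv M * M) *\<^sub>v z = z}"
proof -
  define X where "X = pinv M"
  have X: "X \<in> carrier_mat n m" using pinv_carrier[OF M] by (simp add: X_def)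
  note pen = pinv_penrose[of M, folded X_def]
  have XM: "X * M \<in> carrier_mat n n" using X M by simp
  have "M\<^sup>T = (M * (X * M))\<^sup>T" using pen(1) assoc_mult_mat[OF M X M] by simp
  also have "\<dots> = X * M * M\<^sup>T" using transpose_mult[OF M XM] pen(4) by simp
  finally have Mt: "X * M * M\<^sup>T = M\<^sup>T" by simp
  have "X * M *\<^sub>v (M\<^sup>T *\<^sub>v y) = M\<^sup>T *\<^sub>v y" if "y \<in> carrier_vec m" for y
    using assoc_mult_mat_vec[OF XM, of "M\<^sup>T" m y] M that Mt by simp
  then have 1: "mat_range (M\<^sup>T) \<subseteq> {z \<in> carrier_vec n. X * M *\<^sub>v z = z}"
    using M by (auto simp: mat_range_def)
  have XM_eq: "X * M = M\<^sup>T * X\<^sup>T" using transpose_mult[OF X M] pen(4) by simp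
  have "z \<in> mat_range (M\<^sup>T)" if "z \<in> carrier_vec n" "X * M *\<^sub>v z = z" for z
  proof -
    have "z = M\<^sup>T *\<^sub>v (X\<^sup>T *\<^sub>v z)"
      using that assoc_mult_mat_vec[of "M\<^sup>T" n m "X\<^sup>T" n z] X M by (simp add: XM_eq)
    then show ?thesis using X M that(1)
      by (auto simp: mat_range_def intro!: image_eqI[of _ _ "X\<^sup>T *\<^sub>v z"])
  qed
  then show ?thesis using 1 by (auto simp: X_def)
qed

section \<open>The condition number as a ratio of extremal quotients\<close>

lemma mnorm_eqI:
  assumes B: "B \<in> carrier_mat m n" and u: "u \<in> carrier_vec n" "u \<noteq> 0\<^sub>v n" "vnorm (B *\<^sub>v u) = c * vnorm u"
    and le: "\<And>x. x \<in> carrier_vec n \<Longrightarrow> vnorm (B *\<^sub>v x) \<le> c * vnorm x"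
  shows "mnorm B = c"
  unfolding mnorm_def
proof (rule cSup_eq_maximum)
  show "c \<in> (\<lambda>x. vnorm (B *\<^sub>v x) / vnorm x) ` (carrier_vec (dim_col B) - {0\<^sub>v (dim_col B)})"
    using u B vnorm_pos[OF u(1,2)] by (auto intro!: image_eqI[of _ _ u])
next
  fix t assume "t \<in> (\<lambda>x. vnorm (B *\<^sub>v x) / vnorm x) ` (carrier_vec (dim_col B) - {0\<^sub>v (dim_col B)})"
  then obtain x where "x \<in> carrier_vec n" "x \<noteq> 0\<^sub>v n" "t = vnorm (B *\<^sub>v x) / vnorm x" using B by auto
  then show "t \<le> c" using le[of x] vnorm_pos[of x n] by (simp add: divide_le_eq)
qed

lemma mult_mat_vec_zero:
  assumes "(M :: real mat) \<in> carrier_mat m n"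
  shows "M *\<^sub>v 0\<^sub>v n = 0\<^sub>v m"
  using assms by (intro eq_vecI) auto

text \<open>Let \<open>a\<close> and \<open>c\<close> be the extremal quotients on the row space
  \<open>S\<close>. As Mx = M(XMx) and the projection \<open>X * M\<close> does not increase norms,
  |M| = a. As Xy lies in \<open>S\<close>, c|Xy| \<le> |MXy| \<le> |y|, with equality throughout at
  y = Ml, so |X| = 1/c.\<close>

lemma cond_num_quotients:
  assumes M: "M \<in> carrier_mat m n" and ne: "M \<noteq> 0\<^sub>m m n"
  obtains u l where "u \<in> mat_range (M\<^sup>T) - {0\<^sub>v n}" "l \<in> mat_range (M\<^sup>T) - {0\<^sub>v n}"
    "\<And>z. z \<in> mat_range (M\<^sup>T) - {0\<^sub>v n} \<Longrightarrow> vnorm (M *\<^sub>v z) / vnorm z \<le> vnorm (M *\<^sub>v u) / vnorm u"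
    "\<And>z. z \<in> mat_range (M\<^sup>T) - {0\<^sub>v n} \<Longrightarrow> vnorm (M *\<^sub>v l) / vnorm l \<le> vnorm (M *\<^sub>v z) / vnorm z"
    "vnorm (M *\<^sub>v l) / vnorm l > 0"
    "cond_num M = (vnorm (M *\<^sub>v u) / vnorm u) / (vnorm (M *\<^sub>v l) / vnorm l)"
    "cond_num_on M (mat_range (M\<^sup>T)) = cond_num M"
proof -
  define X where "X = pinv M"
  have X: "X \<in> carrier_mat n m" using pinv_carrier[OF M] by (simp add: X_def)
  note pen = pinv_penrose[of M, folded X_def]
  have XM: "X * M \<in> carrier_mat n n" and MX: "M * X \<in> carrier_mat m m" using X M by auto
  define S where "S = mat_range (M\<^sup>T)"
  have S: "S = {z \<in> carrier_vec n. (X * M) *\<^sub>v z = z}"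
    using mat_range_transpose_eq_fixed[OF M] by (simp add: S_def X_def)
  have XM_idem: "X * M * (X * M) = X * M" using assoc_mult_mat[OF XM X M] pen by simp
  have MX_idem: "M * X * (M * X) = M * X" using assoc_mult_mat[OF MX M X] pen by simp
  have XM_S: "X * M *\<^sub>v x \<in> S" if "x \<in> carrier_vec n" for x
    using assoc_mult_mat_vec[OF XM XM that] XM that by (simp add: S XM_idem)
  have M_XM: "M *\<^sub>v (X * M *\<^sub>v x) = M *\<^sub>v x" if "x \<in> carrier_vec n" for x
    using assoc_mult_mat_vec[OF M XM that] assoc_mult_mat[OF M X M] pen by simp
  \<comment> \<open>Since \<open>M\<close> is nonzero, some \<open>x\<close> has a nonzero image;
    its projection is the nonzero point of \<open>S\<close> that the existence of extrema
    requires.\<close>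
  obtain x where x: "x \<in> carrier_vec n" "M *\<^sub>v x \<noteq> 0\<^sub>v m"
    using mat_eq_if_mult_vec_eq[OF M, of "0\<^sub>m m n"] ne by (force intro!: eq_vecI)
  have "X * M *\<^sub>v x \<noteq> 0\<^sub>v n" using M_XM[OF x(1)] x(2) M by (metis mult_mat_vec_zero)
  from quotient_extrema[OF M XM S XM_S[OF x(1)] this]
  obtain u l where ul: "u \<in> S - {0\<^sub>v n}" "l \<in> S - {0\<^sub>v n}"
    and max: "\<And>z. z \<in> S - {0\<^sub>v n} \<Longrightarrow> vnorm (M *\<^sub>v z) / vnorm z \<le> vnorm (M *\<^sub>v u) / vnorm u"
    and min: "\<And>z. z \<in> S - {0\<^sub>v n} \<Longrightarrow> vnorm (M *\<^sub>v l) / vnorm l \<le> vnorm (M *\<^sub>v z) / vnorm z"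
    by blast
  define a where "a = vnorm (M *\<^sub>v u) / vnorm u"
  define c where "c = vnorm (M *\<^sub>v l) / vnorm l"
  have carr: "u \<in> carrier_vec n" "l \<in> carrier_vec n" using ul by (auto simp: S)
  have up: "vnorm u > 0" and lp: "vnorm l > 0" using ul carr vnorm_pos by auto
  \<comment> \<open>\<open>X\<close> inverts \<open>M\<close> on \<open>S\<close>, so
    \<open>M\<close> is injective there and the minimal quotient is positive.\<close>
  have X_inv: "X *\<^sub>v (M *\<^sub>v z) = z" if "z \<in> S" for z
    using assoc_mult_mat_vec[OF X M, of z] that by (simp add: S)
  have "M *\<^sub>v l \<noteq> 0\<^sub>v m" using X_inv[of l] ul mult_mat_vec_zero[OF X] by auto
  then have cp: "c > 0" using vnorm_pos[of "M *\<^sub>v l" m] M carr lp by (simp add: c_def)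
  have a0: "a \<ge> 0" by (simp add: a_def vnorm_nonneg)
  have le_a: "vnorm (M *\<^sub>v z) \<le> a * vnorm z" and ge_c: "c * vnorm z \<le> vnorm (M *\<^sub>v z)"
    if z: "z \<in> S" for z
  proof -
    have "vnorm (M *\<^sub>v z) \<le> a * vnorm z \<and> c * vnorm z \<le> vnorm (M *\<^sub>v z)"
    proof (cases "z = 0\<^sub>v n")
      case True
      then show ?thesis using mult_mat_vec_zero[OF M] by simp
    next
      case False
      then have "vnorm z > 0" using z vnorm_pos[of z n] by (simp add: S)
      then show ?thesis using max[of z] min[of z] z False
        by (simp add: a_def[symmetric] c_def[symmetric] pos_divide_le_eq pos_le_divide_eq)
    qed
    then show "vnorm (M *\<^sub>v z) \<le> a * vnorm z" "c * vnorm z \<le> vnorm (M *\<^sub>v z)" by auto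
  qed
  have nM: "mnorm M = a"
  proof (rule mnorm_eqI[OF M carr(1)])
    fix x :: "real vec" assume x: "x \<in> carrier_vec n"
    have "vnorm (M *\<^sub>v x) \<le> a * vnorm (X * M *\<^sub>v x)" using le_a[OF XM_S[OF x]] M_XM[OF x] by simp
    also have "\<dots> \<le> a * vnorm x"
      using vnorm_symmetric_idempotent_le[OF XM pen(4) XM_idem x] a0 by (intro mult_left_mono)
    finally show "vnorm (M *\<^sub>v x) \<le> a * vnorm x" .
  qed (use ul up in \<open>auto simp: a_def\<close>)
  have nX: "mnorm X = 1 / c"
  proof (rule mnorm_eqI[OF X, of "M *\<^sub>v l"])
    show "vnorm (X *\<^sub>v (M *\<^sub>v l)) = 1 / c * vnorm (M *\<^sub>v l)"
      using X_inv[of l] ul cp by (auto simp: c_def)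
    fix y :: "real vec" assume y: "y \<in> carrier_vec m"
    have Xy: "X *\<^sub>v y \<in> carrier_vec n" using X y by simp
    have "X *\<^sub>v y \<in> S"
      using assoc_mult_mat_vec[OF XM X y] Xy pen(2) by (simp add: S)
    then have "c * vnorm (X *\<^sub>v y) \<le> vnorm (M *\<^sub>v (X *\<^sub>v y))" by (rule ge_c)
    also have "\<dots> = vnorm (M * X *\<^sub>v y)" using assoc_mult_mat_vec[OF M X y] by simp
    also have "\<dots> \<le> vnorm y" by (rule vnorm_symmetric_idempotent_le[OF MX pen(3) MX_idem y])
    finally show "vnorm (X *\<^sub>v y) \<le> 1 / c * vnorm y" using cp by (simp add: field_simps)
  qed (use \<open>M *\<^sub>v l \<noteq> 0\<^sub>v m\<close> M carr in auto)
  have "cond_num M = a / c" by (simp add: cond_num_def nM nX X_def[symmetric])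
  moreover have "cond_num_on M S = a / c"
  proof -
    have "(GREATEST t. \<exists>z\<in>S - {0\<^sub>v (dim_col M)}. t = vnorm (M *\<^sub>v z) / vnorm z) = a"
      using M ul max unfolding a_def by (intro Greatest_equality) auto
    moreover have "(LEAST t. \<exists>z\<in>S - {0\<^sub>v (dim_col M)}. t = vnorm (M *\<^sub>v z) / vnorm z) = c"
      using M ul min unfolding c_def by (intro Least_equality) auto
    ultimately show ?thesis by (simp add: cond_num_on_def)
  qed
  ultimately show thesis
    using that[OF ul[unfolded S_def]] max min cp by (auto simp: S_def a_def c_def)
qed

section \<open>Krylov spaces and their dimension\<close>

lemma mat_range_carrier:
  assumes "A \<in> carrier_mat n m"
  shows "mat_range A \<subseteq> carrier_vec n"
  using assms by (auto simp: mat_range_def)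

text \<open>Choosing a preimage under \<open>M\<close> for every column yields a factorization of
  the column matrix through \<open>M\<close>.\<close>

lemma mat_range_mat_of_cols_subset:
  assumes M: "M \<in> carrier_mat n m" and qs: "set qs \<subseteq> mat_range M"
  shows "mat_range (mat_of_cols n qs) \<subseteq> mat_range M"
proof -
  have "\<forall>q\<in>set qs. \<exists>x\<in>carrier_vec m. q = M *\<^sub>v x" using qs M by (auto simp: mat_range_def)
  then obtain g where g: "\<And>q. q \<in> set qs \<Longrightarrow> g q \<in> carrier_vec m \<and> q = M *\<^sub>v g q" by metis
  define X where "X = mat_of_cols m (map g qs)"
  have X: "X \<in> carrier_mat m (length qs)" by (simp add: X_def carrier_matI)
  have "mat_of_cols n qs = M * X"
  proof (rule eq_matI)
    fix i j assume "i < dim_row (M * X)" "j < dim_col (M * X)"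
    then have ij: "i < n" "j < length qs" using M X by auto
    have gj: "g (qs ! j) \<in> carrier_vec m" "qs ! j = M *\<^sub>v g (qs ! j)" using g ij by auto
    have "col X j = g (qs ! j)" using gj ij by (simp add: X_def)
    moreover have "(qs ! j) $ i = row M i \<bullet> g (qs ! j)"
      by (subst gj(2)) (use ij M in simp)
    ultimately show "mat_of_cols n qs $$ (i,j) = (M * X) $$ (i,j)"
      using ij M X by (simp add: mat_of_cols_index)
  qed (use M X in auto)
  then show ?thesis using mat_range_mult_subset[OF M X] by simp
qed

lemma vspan_subset_mat_range:
  assumes M: "M \<in> carrier_mat n m" and "S \<subseteq> mat_range M"
  shows "vspan n S \<subseteq> mat_range M"
proof -
  interpret vec_module "TYPE(real)" n .
  show ?thesis unfolding vspan_def
    by (rule span_is_subset[OF assms(2) mat_range_submodule[OF M]])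
qed

lemma vspan_superset:
  assumes "S \<subseteq> carrier_vec n"
  shows "S \<subseteq> vspan n S"
proof -
  interpret vec_module "TYPE(real)" n .
  show ?thesis unfolding vspan_def using in_own_span[of S] assms by simp
qed

text \<open>The dimension of a span is the size of a maximal independent subset of the generators,
  and one chosen within \<open>S\<close> extends to one within \<open>T\<close>.\<close>

lemma subspace_dim_vspan:
  assumes "finite T" "T \<subseteq> carrier_vec n" "S \<subseteq> T"
  shows "subspace_dim n (vspan n S) \<le> subspace_dim n (vspan n T)"
    and "subspace_dim n (vspan n T) \<le> card T"
proof -
  interpret vec_space "TYPE(real)" n .
  define P where "P W = (\<lambda>B. B \<subseteq> W \<and> lin_indpt B)" for W
  have fS: "finite S" and S: "S \<subseteq> carrier_vec n" using assms finite_subset by auto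
  have empty: "P W {}" for W by (simp add: P_def lin_dep_def)
  obtain U where U: "maximal U (P S)"
    using maximal_exists_superset[of S "P S" "{}"] fS empty by (auto simp: P_def)
  then have UP: "P T U" using assms(3) by (auto simp: P_def maximal_def)
  obtain W where W: "finite W" "maximal W (P T)" "U \<subseteq> W"
    using maximal_exists_superset[of T "P T" U] assms(1) UP by (auto simp: P_def)
  have dS: "subspace_dim n (vspan n S) = card U"
    unfolding subspace_dim_def vspan_def using dim_span[of S U] fS S U
    by (simp add: P_def)
  have dT: "subspace_dim n (vspan n T) = card W"
    unfolding subspace_dim_def vspan_def using dim_span[of T W] assms W
    by (simp add: P_def)
  show "subspace_dim n (vspan n S) \<le> subspace_dim n (vspan n T)"
    using W by (simp add: dS dT card_mono)
  have "W \<subseteq> T" using W(2) by (auto simp: maximal_def P_def)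
  then show "subspace_dim n (vspan n T) \<le> card T" using assms by (simp add: dT card_mono)
qed

text \<open>When the \<open>k\<close>-th Krylov space has dimension \<open>k\<close>, these bounds
  leave only \<open>k\<close> and \<open>k + 1\<close> for the next one: the breakdown and the
  regular case of \<open>arnoldi\<close>.\<close>

lemma krylov_dim_Suc:
  assumes A: "A \<in> carrier_mat n n" and r: "r \<in> carrier_vec n"
  shows "subspace_dim n (krylov A r k) \<le> subspace_dim n (krylov A r (k + 1))"
    and "subspace_dim n (krylov A r k) \<le> k"
proof -
  define g where "g i = (A ^\<^sub>m i) *\<^sub>v r" for i
  have sub: "g ` X \<subseteq> carrier_vec n" for X
    using A r by (auto simp: g_def intro!: mult_mat_vec_carrier[of _ n n] pow_carrier_mat)
  have "dim_vec r = n" using r by simp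
  then have kry: "krylov A r j = vspan n (g ` {..<j})" for j by (simp add: krylov_def g_def)
  show "subspace_dim n (krylov A r k) \<le> subspace_dim n (krylov A r (k + 1))"
    unfolding kry using sub by (intro subspace_dim_vspan) auto
  have "subspace_dim n (krylov A r k) \<le> card (g ` {..<k})"
    unfolding kry using sub by (intro subspace_dim_vspan[of _ _ "{}"]) auto
  also have "\<dots> \<le> k" using card_image_le[of "{..<k}" g] by simp
  finally show "subspace_dim n (krylov A r k) \<le> k" .
qed

lemma krylov_subset_mat_range:
  assumes A: "A \<in> carrier_mat n n" and r: "r \<in> mat_range A"
  shows "krylov A r k \<subseteq> mat_range A"
proof -
  have rc: "r \<in> carrier_vec n" using r mat_range_carrier[OF A] by auto
  have "(A ^\<^sub>m i) *\<^sub>v v \<in> mat_range A" if "v \<in> mat_range A" for i v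
    using that
  \<comment> \<open>The power unfolds with the new factor \<open>A\<close> on the right, which acts
    on \<open>v\<close> first; hence the generalisation over \<open>v\<close>.\<close>
  proof (induction i arbitrary: v)
    case 0
    then show ?case using mat_range_carrier[OF A] A by auto
  next
    case (Suc i)
    have v: "v \<in> carrier_vec n" using Suc.prems mat_range_carrier[OF A] by auto
    have "(A ^\<^sub>m Suc i) *\<^sub>v v = (A ^\<^sub>m i) *\<^sub>v (A *\<^sub>v v)"
      using assoc_mult_mat_vec[OF pow_carrier_mat[OF A] A v] by simp
    moreover have "A *\<^sub>v v \<in> mat_range A" using v A by (auto simp: mat_range_def)
    ultimately show ?case using Suc.IH by metis
  qed
  then have "(\<lambda>i. (A ^\<^sub>m i) *\<^sub>v r) ` {..<k} \<subseteq> mat_range A" using r by auto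
  moreover have "dim_vec r = n" using rc by simp
  ultimately show ?thesis unfolding krylov_def using vspan_subset_mat_range[OF A] by metis
qed

section \<open>The Arnoldi relation and the inequality\<close>

text \<open>In either case AQ factors through a matrix with orthonormal columns, which preserves
  norms. The other factor is \<open>H\<close>, or \<open>H\<close> without its last row in case of
  breakdown.\<close>

lemma arnoldi_vnorm:
  assumes A: "A \<in> carrier_mat n n" and r: "r \<in> carrier_vec n"
    and dim: "subspace_dim n (krylov A r k) = k"
    and arn: "arnoldi A r k qs H" and w: "w \<in> carrier_vec k"
  shows "vnorm (A *\<^sub>v (mat_of_cols n qs *\<^sub>v w)) = vnorm (H *\<^sub>v w)"
proof -
  define Q where "Q = mat_of_cols n qs"
  have dn: "dim_vec r = n" using r by simp
  have len: "length qs = k" and qsc: "set qs \<subseteq> carrier_vec n" and on: "orthonormal qs"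
    and H: "H \<in> carrier_mat (k + 1) k"
    using arn by (auto simp: arnoldi_def dn)
  have Q: "Q \<in> carrier_mat n k" by (simp add: Q_def len carrier_matI)
  have QQ: "Q\<^sup>T * Q = 1\<^sub>m k" using on orthonormal_iff_gram[OF qsc] by (simp add: Q_def len)
  have AQ: "A *\<^sub>v (Q *\<^sub>v w) = (A * Q) *\<^sub>v w" using assoc_mult_mat_vec[OF A Q w] by simp
  have "subspace_dim n (krylov A r (k + 1)) \<in> {k, k + 1}"
    using krylov_dim_Suc[OF A r] dim by (metis Suc_eq_plus1 insertCI le_SucE le_antisym)
  then consider "subspace_dim n (krylov A r (k + 1)) = k + 1" | "subspace_dim n (krylov A r (k + 1)) = k"
    by blast
  then show ?thesis
  proof cases
    case 1
    then obtain q where q: "q \<in> carrier_vec n" "orthonormal (qs @ [q])"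
        "A * Q = mat_of_cols n (qs @ [q]) * H"
      using arn by (auto simp: arnoldi_def dn Q_def)
    define Q' where "Q' = mat_of_cols n (qs @ [q])"
    have Q': "Q' \<in> carrier_mat n (k + 1)" by (simp add: Q'_def len carrier_matI)
    have "Q'\<^sup>T * Q' = 1\<^sub>m (k + 1)"
      using q qsc orthonormal_iff_gram[of "qs @ [q]" n] by (simp add: Q'_def len)
    then have "vnorm (Q' *\<^sub>v (H *\<^sub>v w)) = vnorm (H *\<^sub>v w)"
      using vnorm_orthonormal_mult[OF Q'] H w by simp
    then show ?thesis
      using assoc_mult_mat_vec[OF Q' H w] AQ q(3) by (simp add: Q_def Q'_def)
  next
    case 2
    define H' where "H' = mat k k (\<lambda>(i,j). H $$ (i,j))"
    have H': "H' \<in> carrier_mat k k" by (simp add: H'_def)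
    have last: "row H k = 0\<^sub>v k" and eq: "A * Q = Q * H'"
      using arn 2 by (auto simp: arnoldi_def dn Q_def H'_def)
    \<comment> \<open>The last entry of \<open>H *\<^sub>v w\<close> is 0, so dropping it keeps the
      norm.\<close>
    have "(H *\<^sub>v w) $ i = (H' *\<^sub>v w) $ i" if "i < k" for i
      using that H w by (auto simp: H'_def scalar_prod_def)
    moreover have "(H *\<^sub>v w) $ k = 0" using last H w by simp
    ultimately have "(H *\<^sub>v w) \<bullet> (H *\<^sub>v w) = (H' *\<^sub>v w) \<bullet> (H' *\<^sub>v w)"
      using H H' by (simp add: scalar_prod_self_eq_sum)
    then have "vnorm (H *\<^sub>v w) = vnorm (H' *\<^sub>v w)" by (simp add: vnorm_def)
    moreover have "vnorm (Q *\<^sub>v (H' *\<^sub>v w)) = vnorm (H' *\<^sub>v w)"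
      using vnorm_orthonormal_mult[OF Q QQ] H' w by simp
    ultimately show ?thesis
      using assoc_mult_mat_vec[OF Q H' w] AQ eq by (simp add: Q_def)
  qed
qed

theorem mainTheorem3:
  fixes A H :: "real mat" and b x0 r0 :: "real vec" and qs :: "real vec list" and n k :: nat
  assumes "A \<in> carrier_mat n n" and "A \<noteq> 0\<^sub>m n n"
    and "mat_range A = mat_range (A\<^sup>T)"
    and "b \<in> mat_range A" and "x0 \<in> carrier_vec n"
    and "r0 = b - A *\<^sub>v x0"
    and "k \<ge> 1" and "subspace_dim n (krylov A r0 k) = k"
    and "arnoldi A r0 k qs H"
  shows "cond_num H \<le> cond_num_on A (mat_range A) \<and> cond_num_on A (mat_range A) = cond_num A"
proof -
  note A = assms(1)
  define q where "q z = vnorm (A *\<^sub>v z) / vnorm z" for z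
  \<comment> \<open>The extrema live on the row space of \<open>A\<close>; folding the hypothesis on
    the ranges moves them to the range of \<open>A\<close>.\<close>
  obtain u l where ul: "u \<in> mat_range A - {0\<^sub>v n}" "l \<in> mat_range A - {0\<^sub>v n}"
    and max: "\<And>z. z \<in> mat_range A - {0\<^sub>v n} \<Longrightarrow> q z \<le> q u"
    and min: "\<And>z. z \<in> mat_range A - {0\<^sub>v n} \<Longrightarrow> q l \<le> q z"
    and pos: "q l > 0" and cond: "cond_num A = q u / q l"
    and on: "cond_num_on A (mat_range A) = cond_num A"
    using cond_num_quotients[OF assms(1,2), folded assms(3) q_def] by blast
  have r0: "r0 \<in> mat_range A"
    using mat_range_diff_mult_closed[OF A A subset_refl assms(4,5)] assms(6) by simp
  then have r0c: "r0 \<in> carrier_vec n" using mat_range_carrier[OF A] by auto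
  have dn: "dim_vec r0 = n" using r0c by simp
  define Q where "Q = mat_of_cols n qs"
  have len: "length qs = k" and qsc: "set qs \<subseteq> carrier_vec n" and "orthonormal qs"
    and H: "H \<in> carrier_mat (k + 1) k" and span: "\<forall>i\<in>{1..k}. vspan n (set (take i qs)) = krylov A r0 i"
    using assms(9) by (auto simp: arnoldi_def dn)
  then have Q: "Q \<in> carrier_mat n k" and QQ: "Q\<^sup>T * Q = 1\<^sub>m k"
    using orthonormal_iff_gram[OF qsc] by (auto simp: Q_def)
  \<comment> \<open>The case \<open>i = k\<close> of the span condition places the columns of
    \<open>Q\<close> in the Krylov space and thus in the range of \<open>A\<close>.\<close>
  have "vspan n (set qs) = krylov A r0 k" using bspec[OF span, of k] assms(7) len by simp
  then have "set qs \<subseteq> mat_range A"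
    using vspan_superset[OF qsc] krylov_subset_mat_range[OF A r0, of k] by simp
  then have QA: "mat_range Q \<subseteq> mat_range A" unfolding Q_def by (rule mat_range_mat_of_cols_subset[OF A])
  have Qw: "Q *\<^sub>v w \<in> mat_range A - {0\<^sub>v n}" and Hw: "vnorm (H *\<^sub>v w) / vnorm w = q (Q *\<^sub>v w)"
    if w: "w \<in> carrier_vec k" "w \<noteq> 0\<^sub>v k" for w
  proof -
    have nQ: "vnorm (Q *\<^sub>v w) = vnorm w" by (rule vnorm_orthonormal_mult[OF Q QQ w(1)])
    then have "Q *\<^sub>v w \<noteq> 0\<^sub>v n" using vnorm_pos[OF w] by auto
    moreover have "Q *\<^sub>v w \<in> mat_range Q" using Q w by (auto simp: mat_range_def)
    ultimately show "Q *\<^sub>v w \<in> mat_range A - {0\<^sub>v n}" using QA by auto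
    show "vnorm (H *\<^sub>v w) / vnorm w = q (Q *\<^sub>v w)"
      using arnoldi_vnorm[OF A r0c assms(8,9) w(1)] nQ by (simp add: q_def Q_def)
  qed
  \<comment> \<open>\<open>cond_num_quotients\<close> requires a nonzero matrix. If \<open>H\<close>
    vanished, a unit vector, available because \<open>k\<close> is at least 1, would give the
    quotient 0 below the positive minimum \<open>q l\<close>.\<close>
  have "H \<noteq> 0\<^sub>m (k + 1) k"
  proof
    assume H0: "H = 0\<^sub>m (k + 1) k"
    define e :: "real vec" where "e = unit_vec k 0"
    have e: "e \<in> carrier_vec k" "e \<noteq> 0\<^sub>v k" using assms(7) by (auto simp: e_def)
    have "H *\<^sub>v e = 0\<^sub>v (k + 1)" using e by (intro eq_vecI) (auto simp: H0)
    then have "q (Q *\<^sub>v e) = 0" using Hw[OF e] by simp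
    then show False using min[OF Qw[OF e]] pos by simp
  qed
  \<comment> \<open>\<open>v\<close> and \<open>w\<close> realise the extremal quotients of
    \<open>H\<close>; being nonzero, they are carried by \<open>Q\<close> to competitors for the
    extrema of \<open>A\<close> on its range.\<close>
  then obtain v w where vw: "v \<in> mat_range (H\<^sup>T) - {0\<^sub>v k}" "w \<in> mat_range (H\<^sup>T) - {0\<^sub>v k}"
    and cH: "cond_num H = (vnorm (H *\<^sub>v v) / vnorm v) / (vnorm (H *\<^sub>v w) / vnorm w)"
    using cond_num_quotients[OF H] by metis
  then have v: "v \<in> carrier_vec k" "v \<noteq> 0\<^sub>v k" and w: "w \<in> carrier_vec k" "w \<noteq> 0\<^sub>v k"
    using mat_range_carrier[of "H\<^sup>T" k "k + 1"] H by auto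
  have "cond_num H = q (Q *\<^sub>v v) / q (Q *\<^sub>v w)" by (simp add: cH Hw v w)
  also have "\<dots> \<le> q u / q l"
    using max[OF Qw[OF v]] min[OF Qw[OF w]] pos
    by (intro frac_le) (auto simp: q_def vnorm_nonneg)
  finally show ?thesis using on cond by simp
qed

end
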